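(* Let $\mathbb{H}$ be a separable, infinite-dimensional complex Hilbert space and let $\Phi = \{\phi_k\}_{k \ge 0}$ be a sequence in $\mathbb{H}$ such that: (a) the sequence $\Phi' = \{\phi_k\}_{k \ge 1}$ is exact in $\mathbb{H}$; and (b) $\Phi$ has a reproducing partner $\Psi = \{\psi_k\}_{k \ge 0} \subseteq \mathbb{H}$. Then $\Phi'$ is a Schauder basis for $\mathbb{H}$.
   Context: Inner products are linear in the first variable. A sequence is complete if its finite linear span is dense in $\mathbb{H}$; it is minimal if no element lies in the closed linear span of the other elements; it is exact if it is both complete and minimal. A sequence $\{f_k\}_{k\ge 1}$ is a Schauder basis for $\mathbb{H}$ if for each $f \in \mathbb{H}$ there exist unique scalars $c_k$ such that $f = \sum_{k=1}^\infty c_k f_k$, with convergence of the partial sums in norm in the given (natural) ordering. Two sequences $\Psi=\{\psi_k\}_{k\ge 0}$, $\Phi=\{\phi_k\}_{k\ge 0}$ in $\mathbb{H}$ form a reproducing pair $(\Psi,\Phi)$, and $\Psi$ is called a reproducing partner for $\Phi$, if for all $f,g\in\mathbb{H}$ the series $\sum_{k=0}^\infty \langle f,\psi_k\rangle\langle\phi_k,g\rangle$ converges (possibly conditionally, partial sums taken in the natural ordering) and the operator $S_{\Psi,\Phi}:\mathbb{H}\to\mathbb{H}$ weakly defined by $\langle S_{\Psi,\Phi}f,g\rangle=\sum_{k=0}^\infty \langle f,\psi_k\rangle\langle\phi_k,g\rangle$ is bounded and boundedly invertible. *)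

theory Defs
  imports "HOL-Analysis.Analysis"
begin

text \<open>
  Complex inner product spaces, with the inner product linear in the first argument. The
  underlying real normed space provides norm, metric and topology; the norm is the one induced
  by the inner product, and the real scaling is the restriction of the complex one.
\<close>

class complex_inner = real_normed_vector +
  fixes scaleC :: "complex \<Rightarrow> 'a \<Rightarrow> 'a"  (infixr \<open>*\<^sub>C\<close> 75)
    and cinner :: "'a \<Rightarrow> 'a \<Rightarrow> complex"
  assumes scaleC_add_right: "a *\<^sub>C (x + y) = a *\<^sub>C x + a *\<^sub>C y"
    and scaleC_add_left: "(a + b) *\<^sub>C x = a *\<^sub>C x + b *\<^sub>C x"
    and scaleC_scaleC: "a *\<^sub>C b *\<^sub>C x = (a * b) *\<^sub>C x"
    and scaleC_one: "1 *\<^sub>C x = x"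
    and scaleR_scaleC: "r *\<^sub>R x = complex_of_real r *\<^sub>C x"
    and cinner_add_left: "cinner (x + y) z = cinner x z + cinner y z"
    and cinner_scaleC_left: "cinner (a *\<^sub>C x) y = a * cinner x y"
    and cinner_commute: "cinner x y = cnj (cinner y x)"
    and cinner_ge_zero: "0 \<le> Re (cinner x x)"
    and cinner_eq_zero_iff: "cinner x x = 0 \<longleftrightarrow> x = 0"
    and norm_eq_sqrt_cinner: "norm x = sqrt (Re (cinner x x))"

class complex_hilbert_space = complex_inner + complete_space

subclass (in complex_hilbert_space) banach ..

instantiation complex :: complex_hilbert_space
begin

definition scaleC_complex :: "complex \<Rightarrow> complex \<Rightarrow> complex"
  where "scaleC_complex a x = a * x"

definition cinner_complex :: "complex \<Rightarrow> complex \<Rightarrow> complex"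
  where "cinner_complex x y = x * cnj y"

instance
proof
  fix x :: complex
  show "norm x = sqrt (Re (cinner x x))"
    by (simp add: cinner_complex_def cmod_def power2_eq_square)
qed (auto simp: scaleC_complex_def cinner_complex_def algebra_simps scaleR_conv_of_real)

end

global_interpretation complex_vector: vector_space "scaleC :: complex \<Rightarrow> 'a \<Rightarrow> 'a::complex_inner"
  defines cspan = complex_vector.span
  by unfold_locales (rule scaleC_add_right scaleC_add_left scaleC_scaleC scaleC_one)+

definition bounded_clinear :: "('a::complex_inner \<Rightarrow> 'b::complex_inner) \<Rightarrow> bool"
  where "bounded_clinear S \<longleftrightarrow> bounded_linear S \<and> (\<forall>c x. S (c *\<^sub>C x) = c *\<^sub>C S x)"

definition boundedly_invertible :: "('a::complex_inner \<Rightarrow> 'b::complex_inner) \<Rightarrow> bool"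
  where "boundedly_invertible S \<longleftrightarrow> (\<exists>T. bounded_clinear T \<and> T \<circ> S = id \<and> S \<circ> T = id)"

definition complete_seq :: "(nat \<Rightarrow> 'a::complex_inner) \<Rightarrow> bool"
  where "complete_seq f \<longleftrightarrow> closure (cspan (range f)) = UNIV"

text \<open>The other elements are those with a different index, so a repeated vector destroys minimality.\<close>

definition minimal_seq :: "(nat \<Rightarrow> 'a::complex_inner) \<Rightarrow> bool"
  where "minimal_seq f \<longleftrightarrow> (\<forall>k. f k \<notin> closure (cspan (f ` (UNIV - {k}))))"

definition exact_seq :: "(nat \<Rightarrow> 'a::complex_inner) \<Rightarrow> bool"
  where "exact_seq f \<longleftrightarrow> complete_seq f \<and> minimal_seq f"

definition schauder_basis :: "(nat \<Rightarrow> 'a::complex_inner) \<Rightarrow> bool"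
  where "schauder_basis f \<longleftrightarrow> (\<forall>x. \<exists>!c :: nat \<Rightarrow> complex. (\<lambda>k. c k *\<^sub>C f k) sums x)"

definition reproducing_pair :: "(nat \<Rightarrow> 'a::complex_inner) \<Rightarrow> (nat \<Rightarrow> 'a) \<Rightarrow> bool"
  where "reproducing_pair \<psi> \<phi> \<longleftrightarrow>
    (\<forall>f g. summable (\<lambda>k. cinner f (\<psi> k) * cinner (\<phi> k) g)) \<and>
    (\<exists>S. (\<forall>f g. cinner (S f) g = (\<Sum>k. cinner f (\<psi> k) * cinner (\<phi> k) g)) \<and>
         bounded_clinear S \<and> boundedly_invertible S)"

end

theory Submission
  imports Defs
begin

text \<open>
  Minimality of \<open>\<Phi>'\<close> gives a biorthogonal sequence \<open>g\<close>, with partial sum operators \<open>P N\<close>.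
  Testing the reproducing formula against \<open>g j\<close> identifies all of its coefficients except the
  one of \<open>\<phi> 0\<close>, so that \<open>P N f + a f *\<^sub>C (\<phi> 0 - P N (\<phi> 0))\<close> tends weakly to \<open>f\<close>, where \<open>a\<close> is
  a bounded functional. If \<open>a\<close> vanishes on all of \<open>\<Phi>'\<close>, then \<open>a = 0\<close> by completeness; otherwise
  choosing \<open>f\<close> in \<open>\<Phi>'\<close> shows that \<open>\<phi> 0 - P N (\<phi> 0)\<close> tends weakly to \<open>0\<close>. Either way \<open>P N f\<close>
  tends weakly to \<open>f\<close>; by the uniform boundedness principle the \<open>P N\<close> are uniformly bounded,
  and completeness upgrades the convergence to norm convergence.
\<close>

section \<open>Complex inner product spaces\<close>

lemma cinner_add_right: "cinner x (y + z) = cinner x y + cinner x z"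
  by (metis cinner_add_left cinner_commute complex_cnj_add)

lemma cinner_scaleC_right: "cinner x (a *\<^sub>C y) = cnj a * cinner x y"
  by (metis cinner_scaleC_left cinner_commute complex_cnj_mult)

lemma cinner_zero_left [simp]: "cinner 0 y = 0"
  by (metis add_cancel_right_right add_0_right cinner_add_left)

lemma cinner_zero_right [simp]: "cinner x 0 = 0"
  by (metis cinner_commute cinner_zero_left complex_cnj_zero)

lemma cinner_diff_left: "cinner (x - y) z = cinner x z - cinner y z"
  by (metis add_diff_cancel cinner_add_left diff_add_cancel)

lemma cinner_diff_right: "cinner x (y - z) = cinner x y - cinner x z"
  by (metis add_diff_cancel cinner_add_right diff_add_cancel)

lemma cinner_sum_left: "cinner (sum f A) y = (\<Sum>i\<in>A. cinner (f i) y)"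
  by (induction A rule: infinite_finite_induct) (auto simp: cinner_add_left)

lemma cinner_scaleR_left: "cinner (r *\<^sub>R x) y = r *\<^sub>R cinner x y"
  by (simp add: scaleR_scaleC[of r x] cinner_scaleC_left scaleR_conv_of_real)

lemma norm_sq_eq_cinner: "(norm x)\<^sup>2 = Re (cinner x x)"
  by (simp add: norm_eq_sqrt_cinner cinner_ge_zero)

lemma cinner_self: "cinner x x = complex_of_real ((norm x)\<^sup>2)"
proof -
  have "Im (cinner x x) = 0"
    using cinner_commute[of x x] by (metis cnj.simps(2) neg_equal_zero)
  then show ?thesis
    by (simp add: complex_eq_iff norm_sq_eq_cinner)
qed

lemma norm_scaleC: "norm (a *\<^sub>C x) = cmod a * norm x"
proof -
  have "complex_of_real ((norm (a *\<^sub>C x))\<^sup>2) = a * cnj a * cinner x x"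
    by (simp only: cinner_self [symmetric] cinner_scaleC_left cinner_scaleC_right ac_simps)
  also have "\<dots> = complex_of_real ((cmod a * norm x)\<^sup>2)"
    by (simp add: cinner_self complex_norm_square [of a, unfolded of_real_power] power_mult_distrib)
  finally have "(norm (a *\<^sub>C x))\<^sup>2 = (cmod a * norm x)\<^sup>2"
    by (simp only: of_real_eq_iff)
  then show ?thesis
    by simp
qed

text \<open>Also for \<open>y = 0\<close>, where both quotients are \<open>0\<close>.\<close>

lemma norm_sq_diff_projection:
  "(norm (x - (cinner x y / complex_of_real ((norm y)\<^sup>2)) *\<^sub>C y))\<^sup>2
    = (norm x)\<^sup>2 - (cmod (cinner x y))\<^sup>2 / (norm y)\<^sup>2"
proof (cases "y = 0")
  case False
  define n where "n = complex_of_real ((norm y)\<^sup>2)"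
  define c where "c = cinner x y"
  have n: "n \<noteq> 0" "cnj n = n" "cinner y y = n"
    using False by (auto simp: n_def cinner_self)
  have yx: "cinner y x = cnj c"
    unfolding c_def by (rule cinner_commute)
  have "complex_of_real ((norm (x - (c / n) *\<^sub>C y))\<^sup>2)
      = cinner (x - (c / n) *\<^sub>C y) (x - (c / n) *\<^sub>C y)"
    by (rule cinner_self [symmetric])
  also have "\<dots> = cinner x x - c * cnj c / n"
    using n by (simp add: cinner_diff_left cinner_diff_right
        cinner_scaleC_left cinner_scaleC_right yx c_def [symmetric] field_simps)
  also have "\<dots> = complex_of_real ((norm x)\<^sup>2 - (cmod c)\<^sup>2 / (norm y)\<^sup>2)"
    by (simp add: n_def cinner_self complex_norm_square [of c, unfolded of_real_power])
  finally show ?thesis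
    unfolding c_def n_def by (simp only: of_real_eq_iff)
qed (simp add: complex_vector.scale_zero_right)

text \<open>The residual of \<open>x\<close> after projection onto the line through \<open>y\<close>
  has nonnegative squared norm.\<close>

lemma cinner_Cauchy_Schwarz: "cmod (cinner x y) \<le> norm x * norm y"
proof (cases "y = 0")
  case False
  have "(cmod (cinner x y))\<^sup>2 / (norm y)\<^sup>2 \<le> (norm x)\<^sup>2"
    using norm_sq_diff_projection[of x y]
    by (smt (verit) zero_le_power2)
  then have "(cmod (cinner x y))\<^sup>2 \<le> (norm x * norm y)\<^sup>2"
    using False by (simp add: field_simps power_mult_distrib)
  then show ?thesis
    by (rule power2_le_imp_le) simp
qed simp

section \<open>Continuity of the inner product and of scaling; closures of subspaces\<close>

lemma bounded_linear_cinner_left: "bounded_linear (\<lambda>x. cinner x y)"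
  by (rule bounded_linear_intro[where K = "norm y"])
    (auto simp: cinner_add_left cinner_scaleR_left cinner_Cauchy_Schwarz)

lemma tendsto_cinner_left: "(f \<longlongrightarrow> a) F \<Longrightarrow> ((\<lambda>x. cinner (f x) y) \<longlongrightarrow> cinner a y) F"
  by (rule bounded_linear.tendsto[OF bounded_linear_cinner_left])

lemma bounded_linear_scaleC_left: "bounded_linear (\<lambda>c. c *\<^sub>C x)"
  by (rule bounded_linear_intro[where K = "norm x"])
    (auto simp: scaleC_add_left scaleR_scaleC[of _ "_ *\<^sub>C x"] scaleC_scaleC
      scaleR_conv_of_real norm_scaleC)

lemma bounded_linear_scaleC_right: "bounded_linear (\<lambda>x. c *\<^sub>C x)"
  by (rule bounded_linear_intro[where K = "cmod c"])
    (auto simp: scaleC_add_right scaleR_scaleC scaleC_scaleC norm_scaleC mult.commute)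

text \<open>Sums and multiples of approximating sequences stay in \<open>M\<close> and converge.
  This lets the separation of a point from a closed subspace be applied to closures of
  spans.\<close>

lemma csubspace_closure:
  assumes "complex_vector.subspace M"
  shows "complex_vector.subspace (closure M)"
proof (rule complex_vector.subspaceI)
  show "0 \<in> closure M"
    using assms closure_subset complex_vector.subspace_0 by blast
next
  fix x y assume "x \<in> closure M" "y \<in> closure M"
  then obtain u v where "\<And>n. u n \<in> M" "u \<longlonglongrightarrow> x" "\<And>n. v n \<in> M" "v \<longlonglongrightarrow> y"
    unfolding closure_sequential by blast
  then have "\<And>n. u n + v n \<in> M" "(\<lambda>n. u n + v n) \<longlonglongrightarrow> x + y"
    using assms by (auto intro: tendsto_add complex_vector.subspace_add)
  then show "x + y \<in> closure M"
    unfolding closure_sequential by (intro exI[of _ "\<lambda>n. u n + v n"]) blast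
next
  fix c x assume "x \<in> closure M"
  then obtain u where "\<And>n. u n \<in> M" "u \<longlonglongrightarrow> x"
    unfolding closure_sequential by blast
  then have "\<And>n. c *\<^sub>C u n \<in> M" "(\<lambda>n. c *\<^sub>C u n) \<longlonglongrightarrow> c *\<^sub>C x"
    using assms
    by (auto intro: bounded_linear.tendsto[OF bounded_linear_scaleC_right]
        complex_vector.subspace_scale)
  then show "c *\<^sub>C x \<in> closure M"
    unfolding closure_sequential by (intro exI[of _ "\<lambda>n. c *\<^sub>C u n"]) blast
qed

lemma parallelogram_law:
  fixes x y :: "'a::complex_inner"
  shows "(norm (x + y))\<^sup>2 + (norm (x - y))\<^sup>2 = 2 * (norm x)\<^sup>2 + 2 * (norm y)\<^sup>2"
  by (simp add: norm_sq_eq_cinner cinner_add_left cinner_add_right cinner_diff_left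
      cinner_diff_right)

section \<open>Projection theorem and biorthogonal sequences\<close>

text \<open>A sequence in \<open>M\<close> that minimizes the distance to \<open>x\<close> is Cauchy
  by the parallelogram law, and its limit stays in \<open>M\<close> because \<open>M\<close> is
  closed.\<close>

lemma closed_csubspace_nearest_point:
  fixes M :: "'a::complex_hilbert_space set"
  assumes "closed M" and M: "complex_vector.subspace M"
  obtains y where "y \<in> M" "\<And>w. w \<in> M \<Longrightarrow> norm (x - y) \<le> norm (x - w)"
proof -
  define D where "D = (\<lambda>y. (norm (x - y))\<^sup>2) ` M"
  have ne: "D \<noteq> {}"
    using complex_vector.subspace_0[OF M] by (auto simp: D_def)
  have bdd: "bdd_below D"
    by (rule bdd_belowI[of _ 0]) (auto simp: D_def)
  define d where "d = Inf D"
  have d: "d \<le> (norm (x - w))\<^sup>2" if "w \<in> M" for w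
    unfolding d_def using bdd that by (auto intro: cInf_lower simp: D_def)
  have "\<exists>y\<in>M. (norm (x - y))\<^sup>2 < d + 1 / real (Suc n)" for n
    using cInf_lessD[OF ne, of "d + 1 / real (Suc n)"] by (auto simp: d_def D_def)
  then obtain y where yM: "\<And>n. y n \<in> M" and y: "\<And>n. (norm (x - y n))\<^sup>2 < d + 1 / real (Suc n)"
    by metis
  have diff: "(norm (y m - y n))\<^sup>2 \<le> 2 / real (Suc m) + 2 / real (Suc n)" for m n
  proof -
    \<comment> \<open>The midpoint lies in \<open>M\<close>, so its squared distance to
      \<open>x\<close> is at least \<open>d\<close>. In the parallelogram law this cancels the two
      copies of \<open>2 * d\<close> from the other terms and leaves only the errors.\<close>
    define w where "w = (1 / 2) *\<^sub>R (y m + y n)"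
    have "w \<in> M"
      unfolding w_def scaleR_scaleC
      using M yM by (intro complex_vector.subspace_scale complex_vector.subspace_add)
    have "(x - y m) + (x - y n) = 2 *\<^sub>R (x - w)"
      by (simp add: w_def algebra_simps scaleR_2)
    then have "(norm ((x - y m) + (x - y n)))\<^sup>2 = 4 * (norm (x - w))\<^sup>2"
      by (simp add: power_mult_distrib)
    moreover have "norm ((x - y m) - (x - y n)) = norm (y m - y n)"
      by (simp add: norm_minus_commute)
    ultimately have "(norm (y m - y n))\<^sup>2
        = 2 * (norm (x - y m))\<^sup>2 + 2 * (norm (x - y n))\<^sup>2 - 4 * (norm (x - w))\<^sup>2"
      using parallelogram_law[of "x - y m" "x - y n"] by simp
    then show ?thesis
      using y[of m] y[of n] d[OF \<open>w \<in> M\<close>] unfolding divide_inverse by linarith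
  qed
  have "Cauchy y"
  proof (rule metric_CauchyI)
    fix e :: real assume "0 < e"
    \<comment> \<open>For indices from \<open>N\<close> on, the two terms of \<open>diff\<close> add
      up to at most four times this inverse.\<close>
    then obtain N where N: "inverse (real (Suc N)) < e\<^sup>2 / 4"
      using reals_Archimedean[of "e\<^sup>2 / 4"] by auto
    have "dist (y m) (y n) < e" if "m \<ge> N" "n \<ge> N" for m n
    proof -
      have "1 / real (Suc m) \<le> inverse (real (Suc N))" "1 / real (Suc n) \<le> inverse (real (Suc N))"
        using that by (auto simp: field_simps)
      then have "(norm (y m - y n))\<^sup>2 < e\<^sup>2"
        using diff[of m n] N by simp
      then show ?thesis
        using \<open>0 < e\<close> by (simp add: dist_norm power_less_imp_less_base)
    qed
    then show "\<exists>N. \<forall>m\<ge>N. \<forall>n\<ge>N. dist (y m) (y n) < e"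
      by blast
  qed
  then obtain z where z: "y \<longlonglongrightarrow> z"
    using Cauchy_convergent convergent_def by blast
  show thesis
  proof
    show "z \<in> M"
      using \<open>closed M\<close> yM z closed_sequentially by blast
    fix w assume "w \<in> M"
    have "(\<lambda>n. (norm (x - y n))\<^sup>2) \<longlonglongrightarrow> (norm (x - z))\<^sup>2"
      by (intro tendsto_intros z)
    moreover have "(\<lambda>n. d + 1 / real (Suc n)) \<longlonglongrightarrow> d + 0"
      by (intro tendsto_intros LIMSEQ_Suc[OF lim_1_over_n])
    ultimately have "(norm (x - z))\<^sup>2 \<le> d + 0"
      by (rule LIMSEQ_le) (use y less_imp_le in blast)
    then have "(norm (x - z))\<^sup>2 \<le> (norm (x - w))\<^sup>2"
      using d[OF \<open>w \<in> M\<close>] by linarith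
    then show "norm (x - z) \<le> norm (x - w)"
      by (rule power2_le_imp_le) simp
  qed
qed

text \<open>If \<open>y\<close> is the point of \<open>M\<close> nearest to \<open>x\<close>, the
  residual \<open>x - y\<close> is orthogonal to \<open>M\<close> and nonzero; a multiple of it
  serves as \<open>z\<close>.\<close>

lemma closed_csubspace_separation:
  fixes M :: "'a::complex_hilbert_space set"
  assumes "closed M" and M: "complex_vector.subspace M" and "x \<notin> M"
  obtains z where "cinner x z = 1" "\<And>w. w \<in> M \<Longrightarrow> cinner w z = 0"
proof -
  obtain y where y: "y \<in> M" and le: "\<And>w. w \<in> M \<Longrightarrow> norm (x - y) \<le> norm (x - w)"
    using closed_csubspace_nearest_point[OF assms(1,2), of x] by metis
  define z where "z = x - y"
  have orth: "cinner z w = 0" if "w \<in> M" for w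
  proof (cases "w = 0")
    case False
    \<comment> \<open>This is the projection coefficient of \<open>z\<close> on \<open>w\<close>:
      moving \<open>y\<close> by \<open>a\<close> times \<open>w\<close> would lower the squared
      distance by a multiple of the squared modulus of \<open>cinner z w\<close>, which minimality
      of \<open>y\<close> forbids unless that inner product is zero.\<close>
    define a where "a = cinner z w / complex_of_real ((norm w)\<^sup>2)"
    have "y + a *\<^sub>C w \<in> M"
      using M y that complex_vector.subspace_add complex_vector.subspace_scale by blast
    from le[OF this] have "norm z \<le> norm (z - a *\<^sub>C w)"
      by (simp add: z_def algebra_simps)
    then have "(norm z)\<^sup>2 \<le> (norm (z - a *\<^sub>C w))\<^sup>2"
      by (rule power_mono) simp
    then have "(cmod (cinner z w))\<^sup>2 / (norm w)\<^sup>2 \<le> 0"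
      unfolding a_def norm_sq_diff_projection by simp
    then show ?thesis
      using False by (simp add: divide_le_0_iff)
  qed simp
  have orth': "cinner w z = 0" if "w \<in> M" for w
    using orth[OF that] by (metis cinner_commute complex_cnj_zero)
  have "cinner x z = cinner z z"
    using orth'[OF y] by (simp add: z_def cinner_diff_left)
  moreover have "z \<noteq> 0"
    using y \<open>x \<notin> M\<close> by (auto simp: z_def)
  ultimately have nz: "cinner x z \<noteq> 0"
    by (simp add: cinner_eq_zero_iff)
  \<comment> \<open>The scalar is conjugated because the inner product is conjugate-linear in its
    second argument.\<close>
  show thesis
    by (rule that[of "cnj (1 / cinner x z) *\<^sub>C z"])
      (use nz orth' in \<open>auto simp: cinner_scaleC_right\<close>)
qed

text \<open>Minimality puts \<open>e j\<close> outside the closed span of the other vectors;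
  separating the two gives \<open>g j\<close>.\<close>

lemma minimal_seq_biorthogonal:
  fixes e :: "nat \<Rightarrow> 'a::complex_hilbert_space"
  assumes "minimal_seq e"
  obtains g where "\<And>i j. cinner (e i) (g j) = (if i = j then 1 else 0)"
proof -
  have "\<exists>z. \<forall>i. cinner (e i) z = (if i = j then 1 else 0)" for j
  proof -
    let ?M = "closure (cspan (e ` (UNIV - {j})))"
    have "e j \<notin> ?M"
      using assms by (simp add: minimal_seq_def)
    then obtain z where z: "cinner (e j) z = 1" "\<And>w. w \<in> ?M \<Longrightarrow> cinner w z = 0"
      using closed_csubspace_separation[of ?M "e j"]
        csubspace_closure complex_vector.subspace_span closed_closure by metis
    have "e i \<in> ?M" if "i \<noteq> j" for i
      using that by (intro subsetD[OF closure_subset] complex_vector.span_base) auto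
    with z show ?thesis
      by auto
  qed
  then show thesis
    using that by metis
qed

section \<open>Uniform boundedness and Schauder bases\<close>

text \<open>By Baire, one of the closed sets \<open>F m\<close>, which cover the space, contains a
  ball. The bound on that ball is moved to the origin and then scaled to all vectors.\<close>

lemma uniform_boundedness:
  fixes A :: "nat \<Rightarrow> 'a::banach \<Rightarrow> 'b::real_normed_vector"
  assumes lin: "\<And>n. bounded_linear (A n)" and bdd: "\<And>x. Bseq (\<lambda>n. A n x)"
  obtains C where "C > 0" "\<And>n x. norm (A n x) \<le> C * norm x"
proof -
  define F where "F m = {x. \<forall>n. norm (A n x) \<le> real m}" for m :: nat
  have "closed (F m)" for m
  proof -
    have "closed {x. norm (A n x) \<le> real m}" for n
      by (intro closed_Collect_le continuous_intros bounded_linear.continuous_on[OF lin])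
    moreover have "F m = (\<Inter>n. {x. norm (A n x) \<le> real m})"
      by (auto simp: F_def)
    ultimately show ?thesis
      by auto
  qed
  moreover have "\<Union>(range F) = UNIV"
  proof -
    have "\<exists>m. x \<in> F m" for x
    proof -
      obtain K m where "\<And>n. norm (A n x) \<le> K" "K \<le> real m"
        using bdd[of x] real_arch_simple unfolding Bseq_def by blast
      then have "x \<in> F m"
        unfolding F_def by (auto intro: order_trans)
      then show ?thesis ..
    qed
    then show ?thesis
      by auto
  qed
  moreover have "completely_metrizable_space (euclidean :: 'a topology)"
    by (rule completely_metrizable_space_euclidean)
  ultimately have "\<exists>m. interior (F m) \<noteq> {}"
    using Baire_category_alt[of "euclidean :: 'a topology" "range F"] by auto
  then obtain m x where "x \<in> interior (F m)"
    by blast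
  then obtain e where e: "e > 0" "cball x e \<subseteq> F m"
    unfolding mem_interior_cball by blast
  \<comment> \<open>A vector \<open>y\<close> of norm at most \<open>e\<close> is the difference of
    \<open>x + y\<close> and \<open>x\<close>, both in \<open>F m\<close>; hence the factor
    2.\<close>
  have small: "norm (A n y) \<le> 2 * real m" if "norm y \<le> e" for n y
  proof -
    have "x + y \<in> F m" "x \<in> F m"
      using e that by (auto simp: dist_norm subset_iff)
    moreover have "A n y = A n (x + y) - A n x"
      using linear_add[OF bounded_linear.linear[OF lin]] by simp
    ultimately show ?thesis
      unfolding F_def using norm_triangle_ineq4[of "A n (x + y)" "A n x"]
      by (smt (verit) mem_Collect_eq)
  qed
  show thesis
  proof
    \<comment> \<open>The summand 1 keeps the constant positive when \<open>m = 0\<close>.\<close>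
    show "2 * real m / e + 1 > 0"
      using e by (simp add: add_nonneg_pos)
    fix n z
    show "norm (A n z) \<le> (2 * real m / e + 1) * norm z"
    proof (cases "z = 0")
      case True
      then show ?thesis
        using linear_0[OF bounded_linear.linear[OF lin]] by simp
    next
      case False
      have "norm (A n ((e / norm z) *\<^sub>R z)) \<le> 2 * real m"
        using e False by (intro small) simp
      then have "norm (A n z) \<le> 2 * real m / e * norm z"
        using e False by (simp add: linear_scale[OF bounded_linear.linear[OF lin]] field_simps)
      also have "\<dots> \<le> (2 * real m / e + 1) * norm z"
        by (intro mult_right_mono) auto
      finally show ?thesis .
    qed
  qed
qed

text \<open>The functionals \<open>cinner g (u n)\<close> of \<open>g\<close> are pointwise bounded,
  hence uniformly bounded. Evaluating the \<open>n\<close>-th one at \<open>g = u n\<close> bounds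
  the norm of \<open>u n\<close> itself.\<close>

lemma weakly_convergent_Bseq:
  fixes u :: "nat \<Rightarrow> 'a::complex_hilbert_space"
  assumes "\<And>g. convergent (\<lambda>n. cinner (u n) g)"
  shows "Bseq u"
proof -
  have "Bseq (\<lambda>n. cinner g (u n))" for g
  proof -
    \<comment> \<open>Uniform boundedness needs maps linear in \<open>g\<close>, so \<open>g\<close>
      is moved to the first slot; conjugation preserves the modulus.\<close>
    have "norm (cinner g (u n)) = norm (cinner (u n) g)" for n
      by (metis cinner_commute complex_mod_cnj)
    then show ?thesis
      using convergent_imp_Bseq[OF assms[of g]] by (simp add: Bseq_def)
  qed
  then obtain C where "C > 0" and C: "\<And>n g. norm (cinner g (u n)) \<le> C * norm g"
    using uniform_boundedness[of "\<lambda>n g. cinner g (u n)"] bounded_linear_cinner_left by metis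
  have "norm (u n) \<le> C" for n
  proof -
    have "norm (u n) * norm (u n) \<le> C * norm (u n)"
      using C[of "u n" n] by (simp add: cinner_self norm_power power2_eq_square norm_mult)
    then show ?thesis
      using \<open>C > 0\<close> by (metis less_imp_le mult_right_le_imp_le norm_ge_zero order_le_less)
  qed
  then show ?thesis
    by (rule BseqI')
qed

text \<open>For \<open>g\<close> biorthogonal to \<open>e\<close> this is the projection, in general
  oblique, onto the span of the first \<open>N\<close> vectors of \<open>e\<close>.\<close>

definition partial_expansion ::
    "(nat \<Rightarrow> 'a::complex_inner) \<Rightarrow> (nat \<Rightarrow> 'a) \<Rightarrow> nat \<Rightarrow> 'a \<Rightarrow> 'a"
  where "partial_expansion e g N x = (\<Sum>k<N. cinner x (g k) *\<^sub>C e k)"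

lemma bounded_linear_partial_expansion: "bounded_linear (partial_expansion e g N)"
  unfolding partial_expansion_def
  by (intro bounded_linear_sum
      bounded_linear_compose[OF bounded_linear_scaleC_left bounded_linear_cinner_left])

lemma partial_expansion_scaleC:
  "partial_expansion e g N (c *\<^sub>C x) = c *\<^sub>C partial_expansion e g N x"
  by (simp add: partial_expansion_def cinner_scaleC_left complex_vector.scale_sum_right
      scaleC_scaleC)

lemma partial_expansion_basis:
  assumes "\<And>i j. cinner (e i) (g j) = (if i = j then 1 else 0)" and "k < N"
  shows "partial_expansion e g N (e k) = e k"
proof -
  have "partial_expansion e g N (e k) = (\<Sum>j<N. if k = j then e j else 0)"
    unfolding partial_expansion_def assms(1)
    by (intro sum.cong) (auto simp: scaleC_one complex_vector.scale_zero_left)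
  then show ?thesis
    using \<open>k < N\<close> by simp
qed

text \<open>On the span of \<open>e\<close> the partial expansions are eventually constant.
  Pointwise boundedness becomes a uniform bound, which carries convergence from this dense subspace
  to all vectors.\<close>

lemma schauder_basisI:
  fixes e :: "nat \<Rightarrow> 'a::complex_hilbert_space"
  assumes "complete_seq e"
    and biorth: "\<And>i j. cinner (e i) (g j) = (if i = j then 1 else 0)"
    and bdd: "\<And>x. Bseq (\<lambda>N. partial_expansion e g N x)"
  shows "schauder_basis e"
proof -
  let ?P = "partial_expansion e g"
  have lin: "linear (?P N)" for N
    by (intro bounded_linear.linear bounded_linear_partial_expansion)
  obtain C where "C > 0" and C: "\<And>N x. norm (?P N x) \<le> C * norm x"
    using uniform_boundedness[of ?P] bounded_linear_partial_expansion bdd by metis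
  have span: "(\<lambda>N. ?P N x) \<longlonglongrightarrow> x" if "x \<in> cspan (range e)" for x
    using that
  proof (induction rule: complex_vector.span_induct_alt)
    case base
    show ?case
      using linear_0[OF lin] by simp
  next
    case (step c x y)
    then obtain k where "x = e k"
      by blast
    have "eventually (\<lambda>N. ?P N (e k) = e k) sequentially"
      using eventually_gt_at_top[of k]
      by eventually_elim (rule partial_expansion_basis[OF biorth])
    then have "(\<lambda>N. ?P N x) \<longlonglongrightarrow> x"
      unfolding \<open>x = e k\<close> by (rule tendsto_eventually)
    then have "(\<lambda>N. c *\<^sub>C ?P N x + ?P N y) \<longlonglongrightarrow> c *\<^sub>C x + y"
      by (intro tendsto_add step.IH bounded_linear.tendsto[OF bounded_linear_scaleC_right])
    then show ?case
      by (simp add: linear_add[OF lin] partial_expansion_scaleC)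
  qed
  have conv: "(\<lambda>N. ?P N x) \<longlonglongrightarrow> x" for x
  proof (rule metric_LIMSEQ_I)
    fix r :: real assume "r > 0"
    \<comment> \<open>Chosen so that \<open>(C + 1) * d = r / 2\<close>: replacing \<open>x\<close>
      by \<open>y\<close> costs \<open>C * d\<close> inside the operator and \<open>d\<close>
      outside it.\<close>
    define d where "d = r / (2 * (C + 1))"
    have "d > 0"
      using \<open>r > 0\<close> \<open>C > 0\<close> by (simp add: d_def)
    moreover have "x \<in> closure (cspan (range e))"
      using \<open>complete_seq e\<close> by (simp add: complete_seq_def)
    ultimately obtain y where y: "y \<in> cspan (range e)" "dist y x < d"
      unfolding closure_approachable by blast
    obtain N0 where N0: "\<And>N. N \<ge> N0 \<Longrightarrow> dist (?P N y) y < r / 2"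
      using metric_LIMSEQ_D[OF span[OF y(1)], of "r / 2"] \<open>r > 0\<close> by auto
    have "dist (?P N x) x < r" if "N \<ge> N0" for N
    proof -
      have "?P N x - x = ?P N (x - y) + (?P N y - y) + (y - x)"
        by (simp add: linear_diff[OF lin])
      then have "norm (?P N x - x) \<le> norm (?P N (x - y)) + norm (?P N y - y) + norm (y - x)"
        by (metis (no_types, lifting) add_right_mono norm_triangle_ineq order_trans)
      also have "\<dots> \<le> C * norm (x - y) + norm (?P N y - y) + norm (y - x)"
        using C by simp
      also have "\<dots> = (C + 1) * norm (y - x) + norm (?P N y - y)"
        by (simp add: norm_minus_commute algebra_simps)
      also have "\<dots> < (C + 1) * d + r / 2"
        using y(2) N0[OF that] \<open>C > 0\<close>
        by (intro add_strict_mono mult_strict_left_mono) (auto simp: dist_norm)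
      also have "\<dots> = r"
        using \<open>C > 0\<close> by (simp add: d_def field_simps)
      finally show ?thesis
        by (simp add: dist_norm)
    qed
    then show "\<exists>N0. \<forall>N\<ge>N0. dist (?P N x) x < r"
      by blast
  qed
  show ?thesis
    unfolding schauder_basis_def
  proof (intro allI ex1I)
    fix x
    show "(\<lambda>k. cinner x (g k) *\<^sub>C e k) sums x"
      using conv[of x] by (simp add: sums_def partial_expansion_def)
    fix c assume c: "(\<lambda>k. c k *\<^sub>C e k) sums x"
    \<comment> \<open>Pairing any expansion of \<open>x\<close> with \<open>g j\<close> is
      continuous and leaves only the coefficient \<open>c j\<close>.\<close>
    show "c = (\<lambda>k. cinner x (g k))"
    proof
      fix j
      have "(\<lambda>k. cinner (c k *\<^sub>C e k) (g j)) sums cinner x (g j)"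
        by (rule bounded_linear.sums[OF bounded_linear_cinner_left c])
      moreover have "(\<lambda>k. cinner (c k *\<^sub>C e k) (g j)) = (\<lambda>k. if k = j then c k else 0)"
        by (auto simp: cinner_scaleC_left biorth)
      ultimately show "c j = cinner x (g j)"
        using sums_unique2[OF _ sums_single[of j c]] by metis
    qed
  qed
qed

text \<open>The kernel of \<open>a\<close> is a closed subspace containing every \<open>e k\<close>,
  hence also their dense span.\<close>

lemma complete_seq_functional_zero:
  fixes e :: "nat \<Rightarrow> 'a::complex_inner"
  assumes "complete_seq e" and a: "bounded_clinear a" and "\<And>k. a (e k) = (0::complex)"
  shows "a x = 0"
proof -
  have lin: "bounded_linear a" and scale: "\<And>c x. a (c *\<^sub>C x) = c *\<^sub>C a x"
    using a by (auto simp: bounded_clinear_def)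
  have "a y = 0" if "y \<in> cspan (range e)" for y
    using that
    by (induction rule: complex_vector.span_induct_alt)
      (auto simp: linear_0[OF bounded_linear.linear[OF lin]] scale assms(3) scaleC_complex_def
        linear_add[OF bounded_linear.linear[OF lin]])
  then have "cspan (range e) \<subseteq> {y. a y = 0}"
    by blast
  moreover have "closed {y. a y = 0}"
    by (intro closed_Collect_eq continuous_intros bounded_linear.continuous_on[OF lin])
  ultimately have "closure (cspan (range e)) \<subseteq> {y. a y = 0}"
    by (rule closure_minimal)
  then show ?thesis
    using assms(1) by (auto simp: complete_seq_def)
qed

section \<open>Reproducing pairs\<close>

text \<open>Inserting \<open>T x\<close>, with \<open>T\<close> the inverse of \<open>S\<close>,
  into the weak formula for \<open>S\<close> reproduces \<open>x\<close>; the coefficient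
  \<open>a k x\<close> is the inner product of \<open>T x\<close> with
  \<open>\<psi> k\<close>.\<close>

lemma reproducing_pair_weak_expansion:
  fixes \<phi> :: "nat \<Rightarrow> 'a::complex_inner"
  assumes "reproducing_pair \<psi> \<phi>"
  obtains a where "\<And>k. bounded_clinear (a k)"
    "\<And>x y. (\<lambda>k. a k x * cinner (\<phi> k) y) sums cinner x y"
proof -
  obtain S T where sm: "\<And>f g. summable (\<lambda>k. cinner f (\<psi> k) * cinner (\<phi> k) g)"
    and S: "\<And>f g. cinner (S f) g = (\<Sum>k. cinner f (\<psi> k) * cinner (\<phi> k) g)"
    and T: "bounded_clinear T" and ST: "S \<circ> T = id"
    using assms unfolding reproducing_pair_def boundedly_invertible_def by metis
  show thesis
  proof
    show "bounded_clinear (\<lambda>x. cinner (T x) (\<psi> k))" for k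
      using T bounded_linear_compose[OF bounded_linear_cinner_left[of "\<psi> k"], of T]
      by (auto simp: bounded_clinear_def cinner_scaleC_left scaleC_complex_def)
    fix x y
    have "cinner x y = cinner (S (T x)) y"
      using ST by (metis comp_apply id_apply)
    then show "(\<lambda>k. cinner (T x) (\<psi> k) * cinner (\<phi> k) y) sums cinner x y"
      using summable_sums[OF sm] S by metis
  qed
qed

lemma weak_expansion_partial_expansion:
  assumes a: "\<And>x y. (\<lambda>k. a k x * cinner (\<phi> k) y) sums cinner x y"
    and biorth: "\<And>i j. cinner (\<phi> (Suc i)) (g j) = (if i = j then 1 else 0)"
  defines "P \<equiv> partial_expansion (\<lambda>k. \<phi> (Suc k)) g"
  shows "(\<lambda>N. cinner (P N x) y + a 0 x * cinner (\<phi> 0 - P N (\<phi> 0)) y) \<longlonglongrightarrow> cinner x y"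
proof -
  \<comment> \<open>Tested against \<open>g j\<close>, the series keeps only the terms of index 0
    and \<open>Suc j\<close>.\<close>
  have coeff: "a (Suc j) x = cinner x (g j) - a 0 x * cinner (\<phi> 0) (g j)" for j
  proof -
    have "(\<lambda>k. a (Suc k) x * cinner (\<phi> (Suc k)) (g j))
        sums (cinner x (g j) - a 0 x * cinner (\<phi> 0) (g j))"
      using a[of x "g j"] by (subst sums_Suc_iff) simp
    moreover have "(\<lambda>k. a (Suc k) x * cinner (\<phi> (Suc k)) (g j))
        = (\<lambda>k. if k = j then a (Suc k) x else 0)"
      by (auto simp: biorth)
    ultimately show ?thesis
      using sums_unique2[OF sums_single[of j "\<lambda>k. a (Suc k) x"]] by metis
  qed
  \<comment> \<open>The term of index 0 is split off. The other \<open>N\<close> terms, with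
    \<open>coeff\<close> inserted, form \<open>P N x\<close> minus \<open>a 0 x\<close> times
    \<open>P N (\<phi> 0)\<close>.\<close>
  have "(\<Sum>k<Suc N. a k x * cinner (\<phi> k) y)
      = cinner (P N x) y + a 0 x * cinner (\<phi> 0 - P N (\<phi> 0)) y" for N
    unfolding sum.lessThan_Suc_shift coeff P_def partial_expansion_def
    by (simp add: cinner_sum_left cinner_scaleC_left cinner_diff_left sum_distrib_left
        sum_subtractf algebra_simps)
  moreover have "(\<lambda>N. \<Sum>k<Suc N. a k x * cinner (\<phi> k) y) \<longlonglongrightarrow> cinner x y"
    using a[of x y] unfolding sums_def by (rule LIMSEQ_Suc)
  ultimately show ?thesis
    by simp
qed

theorem theorem2p2:
  fixes \<phi> :: "nat \<Rightarrow> 'a::complex_hilbert_space"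
  assumes "separable_space (euclidean :: 'a topology)"
    and "\<not> (\<exists>B :: 'a set. finite B \<and> cspan B = UNIV)"
    and "exact_seq (\<lambda>k. \<phi> (Suc k))"
    and "\<exists>\<psi> :: nat \<Rightarrow> 'a. reproducing_pair \<psi> \<phi>"
  shows "schauder_basis (\<lambda>k. \<phi> (Suc k))"
proof -
  let ?e = "\<lambda>k. \<phi> (Suc k)"
  have complete: "complete_seq ?e" and minimal: "minimal_seq ?e"
    using assms(3) by (auto simp: exact_seq_def)
  obtain g where biorth: "\<And>i j. cinner (\<phi> (Suc i)) (g j) = (if i = j then 1 else 0)"
    using minimal_seq_biorthogonal[OF minimal] by metis
  obtain a where clin: "\<And>k. bounded_clinear (a k)"
    and a: "\<And>x y. (\<lambda>k. a k x * cinner (\<phi> k) y) sums cinner x y"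
    using assms(4) reproducing_pair_weak_expansion by metis
  let ?P = "partial_expansion ?e g"
  define u where "u N = \<phi> 0 - ?P N (\<phi> 0)" for N
  have weak: "(\<lambda>N. cinner (?P N x) y + a 0 x * cinner (u N) y) \<longlonglongrightarrow> cinner x y" for x y
    unfolding u_def by (rule weak_expansion_partial_expansion[OF a biorth])
  have "(\<lambda>N. a 0 x * cinner (u N) y) \<longlonglongrightarrow> 0" for x y
  proof (cases "\<exists>k. a 0 (\<phi> (Suc k)) \<noteq> 0")
    case True
    then obtain k where k: "a 0 (\<phi> (Suc k)) \<noteq> 0"
      by blast
    have "eventually (\<lambda>N. ?P N (\<phi> (Suc k)) = \<phi> (Suc k)) sequentially"
      using eventually_gt_at_top[of k]
      by eventually_elim (rule partial_expansion_basis[of ?e, OF biorth])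
    then have "(\<lambda>N. cinner (?P N (\<phi> (Suc k))) y) \<longlonglongrightarrow> cinner (\<phi> (Suc k)) y"
      by (intro tendsto_cinner_left tendsto_eventually)
    \<comment> \<open>At \<open>\<phi> (Suc k)\<close> the first summand of \<open>weak\<close>
      already has the full limit, so the second must vanish.\<close>
    from tendsto_diff[OF weak[of "\<phi> (Suc k)" y] this]
    have "(\<lambda>N. a 0 (\<phi> (Suc k)) * cinner (u N) y) \<longlonglongrightarrow> 0"
      by simp
    \<comment> \<open>Since \<open>u N\<close> does not depend on the expanded vector, rescaling by
      the nonzero coefficient passes from \<open>\<phi> (Suc k)\<close> to \<open>x\<close>.\<close>
    from tendsto_mult_left[OF this, of "a 0 x / a 0 (\<phi> (Suc k))"] k show ?thesis
      by simp
  next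
    case False
    then have "a 0 x = 0"
      using complete_seq_functional_zero[OF complete clin[of 0]] by blast
    then show ?thesis
      by simp
  qed
  then have "(\<lambda>N. cinner (?P N x) y) \<longlonglongrightarrow> cinner x y" for x y
    using tendsto_diff[OF weak[of x y], of "\<lambda>N. a 0 x * cinner (u N) y" 0] by simp
  \<comment> \<open>Only boundedness is kept from weak convergence; norm convergence then follows
    from the density of the span.\<close>
  then have "Bseq (\<lambda>N. ?P N x)" for x
    by (intro weakly_convergent_Bseq convergentI)
  then show ?thesis
    by (rule schauder_basisI[OF complete biorth])
qed

end
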